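(* Let $G$ be a connected graph with $n$ vertices, $m$ edges and adjacency matrix $A$. Let $\rho$ be the spectral radius (Perron value) of $A$ and let $v$ be the positive Perron eigenvector of $A$ normalized so that $Av=\rho v$ and $\|v\|_2=1$; put $S=\|v\|_1=\sum_{u} v_u$. Let $\epsilon(G)=\rho-\frac{2m}{n}$ and $\operatorname{var}(G)=\frac{1}{n}\sum_{u\in V(G)}\left(d_u-\frac{2m}{n}\right)^2$, where $d_u$ is the degree of $u$. Then $$\epsilon(G)\le \sqrt{\operatorname{var}(G)}\cdot\sqrt{\frac{n}{S^2}-1}.$$
   Context: For a connected graph the adjacency matrix is irreducible, so the Perron eigenvector with positive entries and unit Euclidean norm is unique. *)

theory Defs
  imports
    Complex_Main
    "Jordan_Normal_Form.Spectral_Radius"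
    "Graph_Theory.Digraph_Component"
begin

text \<open>
  Finite simple graphs are the symmetric, loop-free digraphs without parallel arcs of the locale
  \<open>graph\<close>: every undirected edge is represented by two opposite arcs, so the number of edges is
  obtained by counting the unordered pairs of end points, and the degree of a vertex is its
  out-degree.
\<close>

definition num_edges :: "('a, 'b) pre_digraph \<Rightarrow> nat" where
  "num_edges G = card ((\<lambda>e. {tail G e, head G e}) ` arcs G)"

definition avg_degree :: "('a, 'b) pre_digraph \<Rightarrow> real" where
  "avg_degree G = 2 * real (num_edges G) / real (card (verts G))"

definition degree_var :: "('a, 'b) pre_digraph \<Rightarrow> real" where
  "degree_var G =
     (1 / real (card (verts G))) * (\<Sum>u\<in>verts G. (real (out_degree G u) - avg_degree G)\<^sup>2)"

text \<open>
  Rows and columns are numbered by an enumeration \<open>us\<close> of the vertices: index \<open>i\<close> stands for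
  the vertex \<open>us ! i\<close>.
\<close>

definition vertex_enum :: "('a, 'b) pre_digraph \<Rightarrow> 'a list \<Rightarrow> bool" where
  "vertex_enum G us \<longleftrightarrow> distinct us \<and> set us = verts G"

definition adjacency_mat :: "('a, 'b) pre_digraph \<Rightarrow> 'a list \<Rightarrow> real mat" where
  "adjacency_mat G us =
     mat (length us) (length us) (\<lambda>(i, j). if us ! i \<rightarrow>\<^bsub>G\<^esub> us ! j then 1 else 0)"

text \<open>The spectrum of a real matrix is taken over the complex numbers.\<close>

definition real_spectral_radius :: "real mat \<Rightarrow> real" where
  "real_spectral_radius A = spectral_radius (map_mat complex_of_real A)"

definition l1_norm :: "real vec \<Rightarrow> real" where
  "l1_norm v = (\<Sum>i<dim_vec v. \<bar>v $ i\<bar>)"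

definition l2_norm :: "real vec \<Rightarrow> real" where
  "l2_norm v = sqrt (\<Sum>i<dim_vec v. (v $ i)\<^sup>2)"

definition unit_perron_vector :: "real mat \<Rightarrow> real vec \<Rightarrow> bool" where
  "unit_perron_vector A v \<longleftrightarrow>
     eigenvector A v (real_spectral_radius A) \<and> (\<forall>i<dim_vec v. 0 < v $ i) \<and> l2_norm v = 1"

definition spectral_excess :: "('a, 'b) pre_digraph \<Rightarrow> 'a list \<Rightarrow> real" where
  "spectral_excess G us = real_spectral_radius (adjacency_mat G us) - avg_degree G"

end

theory Submission
  imports Defs "HOL-Analysis.L2_Norm"
begin

text \<open>
  Summing the coordinates of \<open>A v = \<rho> v\<close> gives \<open>\<rho> S = (\<Sum>u. d\<^sub>u v\<^sub>u)\<close>. Since the deviations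
  \<open>d\<^sub>u - 2m/n\<close> sum to zero, \<open>\<rho> - 2m/n\<close> is the inner product of the vector of deviations with
  \<open>v/S - 1/n\<close>, whose squared norm is \<open>1/S\<^sup>2 - 1/n\<close>; the bound is the Cauchy--Schwarz inequality.
\<close>

lemma weighted_mean_deviation_le:
  fixes d w :: "'i \<Rightarrow> real"
  assumes "finite I" and "I \<noteq> {}"
    and mean: "(\<Sum>i\<in>I. d i) = real (card I) * a"
    and unit: "(\<Sum>i\<in>I. (w i)\<^sup>2) = 1"
    and S: "S = (\<Sum>i\<in>I. w i)" "S > 0"
  shows "(\<Sum>i\<in>I. d i * w i) / S - a
    \<le> sqrt (1 / real (card I) * (\<Sum>i\<in>I. (d i - a)\<^sup>2)) * sqrt (real (card I) / S\<^sup>2 - 1)"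
proof -
  define n where "n = real (card I)"
  have n: "n > 0"
    using assms(1,2) by (simp add: n_def card_gt_0_iff)
  have dev: "(\<Sum>i\<in>I. d i - a) = 0"
    by (simp add: sum_subtractf mean)
  \<comment> \<open>As the deviations sum to zero, any constant may be subtracted from
    \<open>w i / S\<close>. The entries \<open>w i / S\<close> sum to 1, so their mean is
    \<open>1 / n\<close>, and subtracting the mean makes the second factor of Cauchy-Schwarz as
    short as possible.\<close>
  have "(\<Sum>i\<in>I. (d i - a) * (w i / S - 1 / n))
      = (\<Sum>i\<in>I. (d i * w i) / S - a * (w i / S) - (d i - a) / n)"
    by (rule sum.cong) (simp_all add: algebra_simps diff_divide_distrib)
  also have "\<dots> = (\<Sum>i\<in>I. d i * w i) / S - a * ((\<Sum>i\<in>I. w i) / S) - (\<Sum>i\<in>I. d i - a) / n"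
    by (simp add: sum_subtractf flip: sum_divide_distrib sum_distrib_left)
  also have "\<dots> = (\<Sum>i\<in>I. d i * w i) / S - a"
    using S by (simp add: dev)
  finally have inner: "(\<Sum>i\<in>I. d i * w i) / S - a = (\<Sum>i\<in>I. (d i - a) * (w i / S - 1 / n))" ..
  have "(\<Sum>i\<in>I. (w i / S - 1 / n)\<^sup>2)
      = (\<Sum>i\<in>I. (w i)\<^sup>2 / S\<^sup>2 - 2 / (n * S) * w i + 1 / n\<^sup>2)"
    by (rule sum.cong) (simp_all add: power2_diff power_divide mult_ac)
  also have "\<dots> = (\<Sum>i\<in>I. (w i)\<^sup>2) / S\<^sup>2 - 2 / (n * S) * (\<Sum>i\<in>I. w i) + n * (1 / n\<^sup>2)"
    by (simp add: sum.distrib sum_subtractf sum_divide_distrib sum_distrib_left n_def)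
  also have "\<dots> = 1 / S\<^sup>2 - 1 / n"
    unfolding unit S(1)[symmetric] using S n by (simp add: power2_eq_square field_simps)
  finally have norm: "(\<Sum>i\<in>I. (w i / S - 1 / n)\<^sup>2) = 1 / S\<^sup>2 - 1 / n" .
  \<comment> \<open>\<open>L2_set_mult_ineq\<close> bounds a sum of products of absolute
    values.\<close>
  have "(\<Sum>i\<in>I. (d i - a) * (w i / S - 1 / n))
      \<le> (\<Sum>i\<in>I. \<bar>d i - a\<bar> * \<bar>w i / S - 1 / n\<bar>)"
    by (rule sum_mono) (simp flip: abs_mult)
  also have "\<dots> \<le> L2_set (\<lambda>i. d i - a) I * L2_set (\<lambda>i. w i / S - 1 / n) I"
    by (rule L2_set_mult_ineq)
  also have "\<dots> = sqrt ((\<Sum>i\<in>I. (d i - a)\<^sup>2) * (1 / S\<^sup>2 - 1 / n))"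
    by (simp add: L2_set_def norm real_sqrt_mult)
  \<comment> \<open>A factor \<open>n\<close> moves from the first term to the second, which turns
    the sum of squares into the variance.\<close>
  also have "(\<Sum>i\<in>I. (d i - a)\<^sup>2) * (1 / S\<^sup>2 - 1 / n)
      = (1 / n * (\<Sum>i\<in>I. (d i - a)\<^sup>2)) * (n / S\<^sup>2 - 1)"
    using n by (simp add: field_simps)
  finally show ?thesis
    by (simp only: inner n_def real_sqrt_mult)
qed

text \<open>Summing the coordinates of the product weights each \<open>v $ j\<close> by the sum of
  column \<open>j\<close>. By symmetry this is the sum of row \<open>j\<close>, which for an
  adjacency matrix is a degree.\<close>

lemma symmetric_mat_sum_mult_vec:
  fixes A :: "'a::comm_semiring_1 mat"
  assumes "A \<in> carrier_mat n n" and "v \<in> carrier_vec n"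
    and sym: "\<And>i j. i < n \<Longrightarrow> j < n \<Longrightarrow> A $$ (i, j) = A $$ (j, i)"
  shows "(\<Sum>i<n. (A *\<^sub>v v) $ i) = (\<Sum>j<n. (\<Sum>i<n. A $$ (j, i)) * v $ j)"
proof -
  have "(\<Sum>i<n. (A *\<^sub>v v) $ i) = (\<Sum>i<n. \<Sum>j<n. A $$ (j, i) * v $ j)"
    using assms by (intro sum.cong) (auto simp: scalar_prod_def lessThan_atLeast0)
  also have "\<dots> = (\<Sum>j<n. \<Sum>i<n. A $$ (j, i) * v $ j)"
    by (rule sum.swap)
  finally show ?thesis
    by (simp add: sum_distrib_right)
qed

lemma (in fin_digraph) sum_out_degree: "(\<Sum>u\<in>verts G. out_degree G u) = card (arcs G)"
proof -
  have "card (arcs G) = (\<Sum>u\<in>verts G. card {e \<in> arcs G. tail G e = u})"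
    using sum.group[of "arcs G" "verts G" "tail G" "\<lambda>_. 1::nat"] by (simp add: image_subset_iff)
  then show ?thesis
    by (simp add: out_degree_def out_arcs_def)
qed

text \<open>Each fibre of the map from arcs to unordered end pairs consists of an arc and its
  reverse: symmetry supplies the reverse, the absence of parallel arcs excludes a third member, and
  the absence of loops makes the two distinct.\<close>

lemma (in graph) card_arcs_eq: "card (arcs G) = 2 * num_edges G"
proof -
  let ?ends = "\<lambda>e. {tail G e, head G e}"
  have "card {f \<in> arcs G. ?ends f = ?ends e} = 2" if e: "e \<in> arcs G" for e
  proof -
    have "(tail G e, head G e) \<in> arcs_ends G"
      using e by (auto simp: arcs_ends_def arc_to_ends_def)
    then have "(head G e, tail G e) \<in> arcs_ends G"
      by (rule graph_symmetric)
    then obtain r where r: "r \<in> arcs G" "tail G r = head G e" "head G r = tail G e"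
      by (auto simp: arcs_ends_def arc_to_ends_def)
    have "{f \<in> arcs G. ?ends f = ?ends e} = {e, r}"
      using e r no_multi_arcs by (auto simp: doubleton_eq_iff arc_to_ends_def)
    moreover have "e \<noteq> r"
      using no_loops[OF e] r by auto
    ultimately show ?thesis by simp
  qed
  then have "(\<Sum>E\<in>?ends ` arcs G. card {f \<in> arcs G. ?ends f = E}) = (\<Sum>E\<in>?ends ` arcs G. 2)"
    by (intro sum.cong) auto
  moreover have "card (arcs G) = (\<Sum>E\<in>?ends ` arcs G. card {f \<in> arcs G. ?ends f = E})"
    using sum.image_gen[of "arcs G" "\<lambda>_. 1::nat" ?ends] by simp
  ultimately show ?thesis
    by (simp add: num_edges_def)
qed

text \<open>Without parallel arcs, an arc leaving \<open>u\<close> is determined by its head. This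
  links the degree, which counts arcs, to the 0-1 entries of the adjacency matrix, which record
  adjacent vertices.\<close>

lemma (in digraph) out_degree_eq_card_dominated:
  "out_degree G u = card {w \<in> verts G. u \<rightarrow>\<^bsub>G\<^esub> w}"
proof -
  have "bij_betw (head G) (out_arcs G u) {w \<in> verts G. u \<rightarrow>\<^bsub>G\<^esub> w}"
  proof (rule bij_betw_imageI)
    show "inj_on (head G) (out_arcs G u)"
      by (auto simp: inj_on_def arc_to_ends_def intro: no_multi_arcs)
    show "head G ` out_arcs G u = {w \<in> verts G. u \<rightarrow>\<^bsub>G\<^esub> w}"
      by (auto simp: arcs_ends_def arc_to_ends_def)
  qed
  then show ?thesis
    unfolding out_degree_def by (rule bij_betw_same_card)
qed

lemma sum_nth_vertex_enum:
  assumes "vertex_enum G us"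
  shows "(\<Sum>i<length us. f (us ! i)) = (\<Sum>u\<in>verts G. f u)"
  using assms unfolding vertex_enum_def
  by (intro sum.reindex_bij_betw) (simp add: bij_betw_nth)

lemma (in digraph) adjacency_mat_row_sum:
  assumes us: "vertex_enum G us" and i: "i < length us"
  shows "(\<Sum>j<length us. adjacency_mat G us $$ (i, j)) = real (out_degree G (us ! i))"
proof -
  have "(\<Sum>j<length us. adjacency_mat G us $$ (i, j))
      = (\<Sum>j<length us. if us ! i \<rightarrow>\<^bsub>G\<^esub> us ! j then 1 else 0)"
    using i by (simp add: adjacency_mat_def)
  also have "\<dots> = (\<Sum>w\<in>verts G. if us ! i \<rightarrow>\<^bsub>G\<^esub> w then 1 else 0)"
    by (rule sum_nth_vertex_enum[OF us])
  also have "\<dots> = real (out_degree G (us ! i))"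
    by (simp add: out_degree_eq_card_dominated sum.If_cases Int_def)
  finally show ?thesis .
qed

text \<open>The coordinate sum of \<open>?A *\<^sub>v v\<close> is computed twice: by the
  eigenvector equation and by the row sums of the symmetric matrix.\<close>

lemma (in graph) eigenvalue_mult_sum_eigenvector:
  assumes us: "vertex_enum G us" and ev: "eigenvector (adjacency_mat G us) v k"
  shows "k * (\<Sum>i<length us. v $ i)
    = (\<Sum>i<length us. real (out_degree G (us ! i)) * v $ i)"
proof -
  let ?A = "adjacency_mat G us" and ?n = "length us"
  have A: "?A \<in> carrier_mat ?n ?n"
    by (simp add: adjacency_mat_def)
  have v: "v \<in> carrier_vec ?n" and eq: "?A *\<^sub>v v = k \<cdot>\<^sub>v v"
    using ev A by (auto simp: eigenvector_def)
  have "k * (\<Sum>i<?n. v $ i) = (\<Sum>i<?n. (?A *\<^sub>v v) $ i)"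
    using v by (simp add: eq sum_distrib_left)
  also have "\<dots> = (\<Sum>j<?n. (\<Sum>i<?n. ?A $$ (j, i)) * v $ j)"
    using A v
    by (rule symmetric_mat_sum_mult_vec) (auto simp: adjacency_mat_def dest: graph_symmetric)
  also have "\<dots> = (\<Sum>i<?n. real (out_degree G (us ! i)) * v $ i)"
    by (simp add: adjacency_mat_row_sum[OF us])
  finally show ?thesis .
qed

theorem theorem1p3:
  fixes G :: "('a, 'b) pre_digraph" and us :: "'a list" and v :: "real vec"
  assumes "graph G"
    and "Digraph_Component.connected G"
    and "vertex_enum G us"
    and "unit_perron_vector (adjacency_mat G us) v"
  shows "spectral_excess G us
           \<le> sqrt (degree_var G) * sqrt (real (card (verts G)) / (l1_norm v)\<^sup>2 - 1)"
proof -
  interpret graph G by fact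
  let ?n = "length us" and ?d = "\<lambda>u. real (out_degree G u)"
  let ?\<rho> = "real_spectral_radius (adjacency_mat G us)"
  have card: "card (verts G) = ?n"
    using assms(3) by (auto simp: vertex_enum_def dest: distinct_card)
  have ev: "eigenvector (adjacency_mat G us) v ?\<rho>"
    and pos: "\<And>i. i < dim_vec v \<Longrightarrow> 0 < v $ i" and "l2_norm v = 1"
    using assms(4) by (auto simp: unit_perron_vector_def)
  have dim: "dim_vec v = ?n"
    using ev by (auto simp: eigenvector_def adjacency_mat_def)
  have unit: "(\<Sum>i<?n. (v $ i)\<^sup>2) = 1"
    using \<open>l2_norm v = 1\<close> by (simp add: l2_norm_def dim)
  \<comment> \<open>An empty sum of squares would be 0 instead of 1, so the unit norm forces a
    vertex to exist.\<close>
  then have ne: "{..<?n} \<noteq> {}"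
    by (metis sum.empty zero_neq_one)
  have S: "l1_norm v = (\<Sum>i<?n. v $ i)"
    unfolding l1_norm_def dim using pos dim by (intro sum.cong) (auto simp: less_imp_le)
  have S_pos: "l1_norm v > 0"
    unfolding S using ne pos dim by (intro sum_pos) auto
  \<comment> \<open>Handshake identity: the out-degrees count every arc once, hence every edge
    twice, so \<open>avg_degree G\<close> is indeed the mean of the degrees.\<close>
  have "(\<Sum>i<?n. ?d (us ! i)) = (\<Sum>u\<in>verts G. ?d u)"
    by (rule sum_nth_vertex_enum[OF assms(3)])
  also have "\<dots> = 2 * real (num_edges G)"
    using sum_out_degree card_arcs_eq by (simp flip: of_nat_sum)
  also have "\<dots> = real (card {..<?n}) * avg_degree G"
    using ne by (auto simp: avg_degree_def card)
  finally have mean: "(\<Sum>i<?n. ?d (us ! i)) = real (card {..<?n}) * avg_degree G" .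
  \<comment> \<open>The spectral radius is thus the mean of the degrees with weights
    \<open>v $ i / l1_norm v\<close>, to be compared with their uniform mean.\<close>
  have "?\<rho> = (\<Sum>i<?n. ?d (us ! i) * v $ i) / l1_norm v"
    using eigenvalue_mult_sum_eigenvector[OF assms(3) ev] S S_pos by (simp add: field_simps)
  moreover have "degree_var G
      = 1 / real (card {..<?n}) * (\<Sum>i<?n. (?d (us ! i) - avg_degree G)\<^sup>2)"
    using sum_nth_vertex_enum[OF assms(3), of "\<lambda>u. (?d u - avg_degree G)\<^sup>2"]
    by (simp add: degree_var_def card)
  ultimately show ?thesis
    using weighted_mean_deviation_le[OF finite_lessThan ne mean unit S S_pos]
    by (simp add: spectral_excess_def card)
qed

end
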